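(* Let $(F,\partial)$, $\mathbf{B}$, $W$, $\tau$, $W_0$ and $P=(P_0,P_1)$ be as in the context. Let $(\partial,\mathbf{u}),(\delta,\mathbf{v})\in W_0$ (that is, $\delta\in\mathbf{B}$, $\mathbf{u}\in W_{0\partial}$, $\mathbf{v}\in W_{0\delta}$). Then $(\partial,\mathbf{u})$ and $(\delta,\mathbf{v})$ are $G$-equivalent, i.e. there exists $(h,g)\in GL(n,F)\times GL^{\partial}(m,F)$ with $\delta=g^{-1}\partial$ and $\mathbf{v}=\tau^{\partial}\langle h,g;\mathbf{u}\rangle$, if and only if $$P_1^{\partial}\langle\mathbf{u}\rangle^{-1}\partial=P_1^{\delta}\langle\mathbf{v}\rangle^{-1}\delta\quad\text{and}\quad \tau^{\partial}\langle P^{\partial}\langle\mathbf{u}\rangle;\mathbf{u}\rangle=\tau^{\delta}\langle P^{\delta}\langle\mathbf{v}\rangle;\mathbf{v}\rangle .$$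
   Context: Fix natural numbers $l,m,n$. $(F,\partial)$ is a field with commuting derivations $\partial^1,\dots,\partial^m$ which are linearly independent over $F$; $\partial$ also denotes the column with entries $\partial^1,\dots,\partial^m$; $C=\{a\in F:\partial^1a=\dots=\partial^ma=0\}$ is the constant field. For a column $\delta=(\delta^1,\dots,\delta^m)^t$ of commuting derivations of $F$ put $GL^{\delta}(m,F)=\{g=(g^i_j)\in GL(m,F): \delta^i g^j_k=\delta^j g^i_k \text{ for all } i,j,k\}$, where $g^i_j$ is the entry in row $i$, column $j$. For $g\in GL(m,F)$, $g^{-1}\delta$ is the column obtained by matrix multiplication. $\mathbf{B}=\{g^{-1}\partial: g\in GL^{\partial}(m,F)\}$; for $\delta=g^{-1}\partial\in \mathbf{B}$ the $\delta^i$ commute, have the same constant field $C$, and $GL^{\delta}(m,F)=g^{-1}GL^{\partial}(m,F)$. For each $\delta\in\mathbf{B}$ let $W_\delta\subset F^l$ be a subset ($F^l$ being regarded as a space over the $\delta$-differential field $F$), and let $W=\bigcup_{\delta\in\mathbf{B}}(\delta,W_\delta)$, the set of pairs $(\delta,v)$ with $v\in W_\delta$. It is assumed that an action is given: for each $\delta\in\mathbf{B}$, $(h,g)\in GL(n,F)\times GL^{\delta}(m,F)$ and $v\in W_\delta$, an element $\tau^{\delta}\langle h,g;v\rangle\in W_{g^{-1}\delta}$, such that $\tau^{\delta}\langle I_n,I_m;v\rangle=v$ and $$\tau^{g^{-1}\delta}\langle h_1,g_1;\tau^{\delta}\langle h,g;v\rangle\rangle=\tau^{\delta}\langle hh_1,gg_1;v\rangle$$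 for all $h,h_1\in GL(n,F)$, $g\in GL^{\delta}(m,F)$, $g_1\in GL^{g^{-1}\delta}(m,F)$, $v\in W_\delta$. The components of $\tau^\delta$ are $\delta$-differential rational functions over $C$ in the components of $h,g,v$, given by expressions that do not depend on $\delta$ except that the derivations used are $\delta^1,\dots,\delta^m$. $W_0=\bigcup_{\delta}(\delta,W_{0\delta})\subset W$ is a nonempty $G$-invariant subset: $\tau^\delta\langle h,g;v\rangle\in W_{0\,g^{-1}\delta}$ whenever $v\in W_{0\delta}$ and $(h,g)\in GL(n,F)\times GL^\delta(m,F)$. It is assumed that there is given a family of maps $P^{\delta}=(P_0^\delta,P_1^\delta):W_{0\delta}\to GL(n,F)\times GL^{\delta}(m,F)$, $\delta\in\mathbf{B}$, with $$P_0^{g^{-1}\delta}\langle\tau^{\delta}\langle h,g;\mathbf{v}\rangle\rangle=h^{-1}P_0^{\delta}\langle\mathbf{v}\rangle,\qquad P_1^{g^{-1}\delta}\langle\tau^{\delta}\langle h,g;\mathbf{v}\rangle\rangle=g^{-1}P_1^{\delta}\langle\mathbf{v}\rangle$$ for all $\delta\in\mathbf{B}$, $\mathbf{v}\in W_{0\delta}$, $(h,g)\in GL(n,F)\times GL^{\delta}(m,F)$, the components of $P^\delta\langle\mathbf{v}\rangle$ being $\delta$-differential rational functions of $\mathbf{v}$ over $C$, given by expressions independent of $\delta$ in the same sense. $\tau^{\delta}\langle P^{\delta}\langle\mathbf{v}\rangle;\mathbf{v}\rangle$ means $\tau^{\delta}\langle P_0^{\delta}\langle\mathbf{v}\rangle,P_1^{\delta}\langle\mathbf{v}\rangle;\mathbf{v}\rangle$.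 *)

theory Defs
  imports "HOL-Analysis.Determinants"
begin

definition derivation :: "('a::field \<Rightarrow> 'a) \<Rightarrow> bool" where
  "derivation d \<longleftrightarrow>
     (\<forall>a b. d (a + b) = d a + d b) \<and> (\<forall>a b. d (a * b) = d a * b + a * d b)"

definition commuting_derivations :: "('a::field \<Rightarrow> 'a) ^ 'm \<Rightarrow> bool" where
  "commuting_derivations \<delta> \<longleftrightarrow>
     (\<forall>i. derivation (\<delta> $ i)) \<and> (\<forall>i j a. (\<delta> $ i) ((\<delta> $ j) a) = (\<delta> $ j) ((\<delta> $ i) a))"

definition lin_independent_over_field :: "('a::field \<Rightarrow> 'a) ^ 'm \<Rightarrow> bool" where
  "lin_independent_over_field \<delta> \<longleftrightarrow>
     (\<forall>c :: 'a ^ 'm. (\<forall>a. (\<Sum>i\<in>UNIV. c $ i * (\<delta> $ i) a) = 0) \<longrightarrow> c = 0)"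

definition const_field :: "('a::field \<Rightarrow> 'a) ^ 'm \<Rightarrow> 'a set" where
  "const_field \<delta> = {a. \<forall>i. (\<delta> $ i) a = 0}"

definition mat_col :: "'a::field ^ 'm ^ 'm \<Rightarrow> ('a \<Rightarrow> 'a) ^ 'm \<Rightarrow> ('a \<Rightarrow> 'a) ^ 'm"
    (infixr "\<cdot>" 75) where
  "g \<cdot> \<delta> = (\<chi> i. (\<lambda>a. \<Sum>j\<in>UNIV. g $ i $ j * (\<delta> $ j) a))"

definition GL :: "('a::field ^ 'n ^ 'n) set" where
  "GL = {g. invertible g}"

definition GLd :: "('a::field \<Rightarrow> 'a) ^ 'm \<Rightarrow> ('a ^ 'm ^ 'm) set" where
  "GLd \<delta> = {g \<in> GL. \<forall>i j k. (\<delta> $ i) (g $ j $ k) = (\<delta> $ j) (g $ i $ k)}"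

definition frames :: "('a::field \<Rightarrow> 'a) ^ 'm \<Rightarrow> (('a \<Rightarrow> 'a) ^ 'm) set" where
  "frames D = {matrix_inv g \<cdot> D | g. g \<in> GLd D}"

text \<open>
  Differential rational expressions in indeterminates of type \<open>'x\<close>, with coefficients in \<open>'a\<close> and
  formal derivation symbols indexed by \<open>'m\<close>.  An expression does not mention a particular column
  of derivations; the column is only chosen when the expression is evaluated.
\<close>

datatype (dr_coeffs: 'a, dr_vars: 'x, dr_ders: 'm) dr_expr =
    Coeff 'a
  | Indet 'x
  | Der 'm "('a, 'x, 'm) dr_expr"
  | Add "('a, 'x, 'm) dr_expr" "('a, 'x, 'm) dr_expr"
  | Mul "('a, 'x, 'm) dr_expr" "('a, 'x, 'm) dr_expr"
  | Quot "('a, 'x, 'm) dr_expr" "('a, 'x, 'm) dr_expr"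

primrec dr_value :: "('a::field \<Rightarrow> 'a) ^ 'm \<Rightarrow> ('x \<Rightarrow> 'a) \<Rightarrow> ('a, 'x, 'm) dr_expr \<Rightarrow> 'a" where
  "dr_value \<delta> \<rho> (Coeff c) = c"
| "dr_value \<delta> \<rho> (Indet x) = \<rho> x"
| "dr_value \<delta> \<rho> (Der i e) = (\<delta> $ i) (dr_value \<delta> \<rho> e)"
| "dr_value \<delta> \<rho> (Add e f) = dr_value \<delta> \<rho> e + dr_value \<delta> \<rho> f"
| "dr_value \<delta> \<rho> (Mul e f) = dr_value \<delta> \<rho> e * dr_value \<delta> \<rho> f"
| "dr_value \<delta> \<rho> (Quot e f) = dr_value \<delta> \<rho> e / dr_value \<delta> \<rho> f"

text \<open>The point \<open>\<rho>\<close> lies in the domain of an expression if no denominator vanishes there, so that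
  the convention \<open>x / 0 = 0\<close> is never used.\<close>

primrec dr_defined :: "('a::field \<Rightarrow> 'a) ^ 'm \<Rightarrow> ('x \<Rightarrow> 'a) \<Rightarrow> ('a, 'x, 'm) dr_expr \<Rightarrow> bool" where
  "dr_defined \<delta> \<rho> (Coeff c) \<longleftrightarrow> True"
| "dr_defined \<delta> \<rho> (Indet x) \<longleftrightarrow> True"
| "dr_defined \<delta> \<rho> (Der i e) \<longleftrightarrow> dr_defined \<delta> \<rho> e"
| "dr_defined \<delta> \<rho> (Add e f) \<longleftrightarrow> dr_defined \<delta> \<rho> e \<and> dr_defined \<delta> \<rho> f"
| "dr_defined \<delta> \<rho> (Mul e f) \<longleftrightarrow> dr_defined \<delta> \<rho> e \<and> dr_defined \<delta> \<rho> f"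
| "dr_defined \<delta> \<rho> (Quot e f) \<longleftrightarrow>
     dr_defined \<delta> \<rho> e \<and> dr_defined \<delta> \<rho> f \<and> dr_value \<delta> \<rho> f \<noteq> 0"

text \<open>
  \<open>X\<close> is the set of pairs (column of derivations, argument) on which \<open>f\<close> is considered, and
  \<open>coords\<close> lists the components of an argument.  A single expression \<open>e\<close> over \<open>C\<close> serves all
  columns \<open>\<delta>\<close> at once.
\<close>

definition diff_rational ::
  "'a::field set \<Rightarrow> ((('a \<Rightarrow> 'a) ^ 'm) \<times> 'p) set \<Rightarrow> ('p \<Rightarrow> 'x \<Rightarrow> 'a) \<Rightarrow>
   (('a \<Rightarrow> 'a) ^ 'm \<Rightarrow> 'p \<Rightarrow> 'a) \<Rightarrow> bool" where
  "diff_rational C X coords f \<longleftrightarrow>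
     (\<exists>e :: ('a, 'x, 'm) dr_expr. dr_coeffs e \<subseteq> C \<and>
        (\<forall>(\<delta>, p) \<in> X. dr_defined \<delta> (coords p) e \<and> f \<delta> p = dr_value \<delta> (coords p) e))"

fun hgv_coords ::
  "('a ^ 'n ^ 'n) \<times> ('a ^ 'm ^ 'm) \<times> ('a ^ 'l) \<Rightarrow> ('n \<times> 'n) + ('m \<times> 'm) + 'l \<Rightarrow> 'a" where
  "hgv_coords (h, g, v) (Inl (i, j)) = h $ i $ j"
| "hgv_coords (h, g, v) (Inr (Inl (i, j))) = g $ i $ j"
| "hgv_coords (h, g, v) (Inr (Inr k)) = v $ k"

end

theory Submission
  imports Defs
begin

text \<open>
  The point \<open>\<tau>\<^sup>\<delta>\<langle>P\<^sup>\<delta>\<langle>v\<rangle>; v\<rangle>\<close> over the column \<open>P\<^sub>1\<^sup>\<delta>\<langle>v\<rangle>\<^sup>-\<^sup>1\<delta>\<close> is a canonical representative of the orbit of \<open>(\<delta>, v)\<close>.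
  Equivariance of \<open>P\<close> makes it constant on orbits; conversely, if the representatives of two points
  agree, \<open>P\<^sup>\<partial>\<langle>u\<rangle>\<close> followed by the inverse of \<open>P\<^sup>\<delta>\<langle>v\<rangle>\<close> carries one point to the other.  This needs
  that the sets \<open>GL\<^sup>\<delta>\<close> form a groupoid.
\<close>

section \<open>Inverses of square matrices over a field\<close>

lemma invertible_imp_matrix_inv:
  fixes A :: "'a::field ^ 'n ^ 'n"
  assumes "invertible A"
  shows "A ** matrix_inv A = mat 1" "matrix_inv A ** A = mat 1"
  using someI_ex[OF assms[unfolded invertible_def]] unfolding matrix_inv_def by auto

lemma invertible_matrix_inv:
  fixes A :: "'a::field ^ 'n ^ 'n"
  assumes "invertible A"
  shows "invertible (matrix_inv A)"
  using invertible_imp_matrix_inv[OF assms] unfolding invertible_def by blast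

text \<open>One equation suffices because a one-sided inverse of a square matrix over a field is
  two-sided.\<close>

lemma matrix_inv_eqI:
  fixes A B :: "'a::field ^ 'n ^ 'n"
  assumes "A ** B = mat 1"
  shows "matrix_inv A = B"
proof -
  have "invertible A"
    using assms matrix_left_right_inverse unfolding invertible_def by blast
  then have "matrix_inv A ** (A ** B) = B"
    by (simp add: matrix_mul_assoc invertible_imp_matrix_inv)
  then show ?thesis
    by (simp add: assms)
qed

lemma matrix_inv_quotient:
  fixes A B :: "'a::field ^ 'n ^ 'n"
  assumes "invertible A" "invertible B"
  shows "matrix_inv (A ** matrix_inv B) = B ** matrix_inv A"
proof (rule matrix_inv_eqI)
  have "A ** matrix_inv B ** (B ** matrix_inv A) = A ** (matrix_inv B ** B) ** matrix_inv A"
    by (simp only: matrix_mul_assoc)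
  then show "A ** matrix_inv B ** (B ** matrix_inv A) = mat 1"
    using assms by (simp add: invertible_imp_matrix_inv)
qed

section \<open>Matrices acting on columns of derivations\<close>

lemma mat_col_mult: "(g ** h) \<cdot> \<delta> = g \<cdot> (h \<cdot> \<delta>)"
proof -
  \<comment> \<open>The entries of \<open>g\<close> and \<open>h\<close> only multiply the values of
    the derivations and are never differentiated, so an exchange of sums is all that is
    involved.\<close>
  have "(\<Sum>j\<in>UNIV. (\<Sum>k\<in>UNIV. g $ i $ k * h $ k $ j) * (\<delta> $ j) a) =
        (\<Sum>k\<in>UNIV. g $ i $ k * (\<Sum>j\<in>UNIV. h $ k $ j * (\<delta> $ j) a))" for i a
    unfolding sum_distrib_left sum_distrib_right mult.assoc by (rule sum.swap)
  then show ?thesis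
    by (simp add: mat_col_def matrix_matrix_mult_def)
qed

lemma mat_col_one [simp]: "mat 1 \<cdot> \<delta> = \<delta>"
  by (simp add: mat_col_def mat_def vec_eq_iff if_distrib[of "\<lambda>x. x * _"] cong: if_cong)

lemma mat_col_matrix_inv_cancel:
  assumes "invertible g"
  shows "g \<cdot> (matrix_inv g \<cdot> \<delta>) = \<delta>"
  by (simp add: invertible_imp_matrix_inv assms flip: mat_col_mult)

section \<open>Derivations\<close>

lemma derivation_zero: "derivation d \<Longrightarrow> d 0 = 0"
  unfolding derivation_def by (metis add_cancel_right_right)

lemma derivation_one: "derivation d \<Longrightarrow> d 1 = 0"
  unfolding derivation_def by (metis add_cancel_right_right mult.right_neutral mult_1)

lemma derivation_sum:
  assumes "derivation d"
  shows "d (sum f A) = (\<Sum>x\<in>A. d (f x))"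
  \<comment> \<open>For empty or infinite \<open>A\<close> both sums are 0, and the claim becomes
    \<open>d 0 = 0\<close>.\<close>
  using assms derivation_zero[OF assms]
  by (induction A rule: infinite_finite_induct) (auto simp: derivation_def)

lemma derivation_mat_col:
  assumes "\<And>j. derivation (\<delta> $ j)"
  shows "derivation ((g \<cdot> \<delta>) $ i)"
  using assms
  by (simp add: derivation_def mat_col_def sum.distrib sum_distrib_left algebra_simps)

section \<open>Groupoid structure of the sets \<open>GLd\<close>\<close>

lemma mat_one_in_GLd:
  fixes \<delta> :: "('a::field \<Rightarrow> 'a) ^ 'm"
  assumes "\<And>i. derivation (\<delta> $ i)"
  shows "mat 1 \<in> GLd \<delta>"
proof -
  have "invertible (mat 1 :: 'a ^ 'm ^ 'm)"
    unfolding invertible_def by (metis matrix_mul_lid)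
  then show ?thesis
    using assms by (auto simp: GLd_def GL_def mat_def derivation_zero derivation_one)
qed

text \<open>Transposition commutes with the congruence by \<open>g\<close>, and the congruence by
  \<open>matrix_inv g\<close> undoes it. This will transfer the symmetry condition in
  \<open>GLd\<close> from one column of derivations to another.\<close>

lemma congruence_symmetric_iff:
  fixes g A :: "'a::field ^ 'n ^ 'n"
  assumes "invertible g"
  shows "transpose (g ** A ** transpose g) = g ** A ** transpose g \<longleftrightarrow> transpose A = A"
proof
  assume "transpose (g ** A ** transpose g) = g ** A ** transpose g"
  then have "g ** transpose A ** transpose g = g ** A ** transpose g"
    by (simp add: matrix_transpose_mul matrix_mul_assoc)
  moreover have "transpose g ** transpose (matrix_inv g) = mat 1"
    by (simp add: invertible_imp_matrix_inv assms transpose_mat flip: matrix_transpose_mul)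
  then have "matrix_inv g ** (g ** B ** transpose g) ** transpose (matrix_inv g) = B" for B
    by (metis assms invertible_imp_matrix_inv(2) matrix_mul_assoc matrix_mul_lid matrix_mul_rid)
  ultimately show "transpose A = A"
    by metis
qed (simp add: matrix_transpose_mul matrix_mul_assoc)

text \<open>Membership of \<open>k\<close> in \<open>GLd \<epsilon>\<close> says that, for each
  column of \<open>k\<close>, the matrix of its \<epsilon>-derivatives is symmetric. With \<delta>
  written as \<open>g\<close> applied to \<epsilon>, the product rule turns this matrix into a
  congruent one, up to a symmetric term. The equivalence gives closure under composition and, read
  backwards, under inverses.\<close>

lemma mult_in_GLd_iff:
  fixes \<delta> :: "('a::field \<Rightarrow> 'a) ^ 'm"
  assumes der: "\<And>i. derivation (\<delta> $ i)" and g: "g \<in> GLd \<delta>" and k: "invertible k"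
  shows "g ** k \<in> GLd \<delta> \<longleftrightarrow> k \<in> GLd (matrix_inv g \<cdot> \<delta>)"
proof -
  define \<epsilon> where "\<epsilon> = matrix_inv g \<cdot> \<delta>"
  have inv_g: "invertible g"
    using g by (simp add: GLd_def GL_def)
  then have \<delta>_eq: "\<delta> = g \<cdot> \<epsilon>"
    by (simp add: \<epsilon>_def mat_col_matrix_inv_cancel)
  have sym_g: "(\<delta> $ i) (g $ j $ r) = (\<delta> $ j) (g $ i $ r)" for i j r
    using g by (simp add: GLd_def)
  define A :: "'m \<Rightarrow> 'a ^ 'm ^ 'm" where "A l = (\<chi> s r. (\<epsilon> $ s) (k $ r $ l))" for l
  \<comment> \<open>The first summand is symmetric in \<open>i, j\<close> since \<open>g \<in> GLd \<delta>\<close>; the second is so iff \<open>A l\<close> is symmetric.\<close>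
  have product_rule: "(\<delta> $ i) ((g ** k) $ j $ l) =
      (\<Sum>r\<in>UNIV. (\<delta> $ i) (g $ j $ r) * k $ r $ l) + (g ** A l ** transpose g) $ i $ j" for i j l
  proof -
    have "(\<delta> $ i) ((g ** k) $ j $ l) =
        (\<Sum>r\<in>UNIV. (\<delta> $ i) (g $ j $ r) * k $ r $ l) +
        (\<Sum>r\<in>UNIV. g $ j $ r * (\<delta> $ i) (k $ r $ l))"
      using der[of i]
      by (simp add: matrix_matrix_mult_def derivation_sum sum.distrib[symmetric] derivation_def)
    \<comment> \<open>Row \<open>i\<close> of \<open>g\<close> expresses \<open>\<delta> $ i\<close>
      through the derivations in \<epsilon>.\<close>
    moreover have "(\<delta> $ i) (k $ r $ l) = (g ** A l) $ i $ r" for r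
      by (subst \<delta>_eq) (simp add: mat_col_def matrix_matrix_mult_def A_def)
    ultimately show ?thesis
      by (simp add: matrix_matrix_mult_def[of "g ** A l"] transpose_def mult.commute)
  qed
  have "invertible (g ** k)"
    by (rule invertible_mult[OF inv_g k])
  then have "g ** k \<in> GLd \<delta> \<longleftrightarrow>
      (\<forall>l. transpose (g ** A l ** transpose g) = g ** A l ** transpose g)"
    unfolding GLd_def GL_def
    by (auto simp: product_rule sym_g vec_eq_iff transpose_def)
  also have "\<dots> \<longleftrightarrow> k \<in> GLd \<epsilon>"
    unfolding congruence_symmetric_iff[OF inv_g]
    using k by (auto simp: GLd_def GL_def A_def transpose_def vec_eq_iff)
  finally show ?thesis
    by (simp add: \<epsilon>_def)
qed

text \<open>Cancellation of \<open>g\<close> from the product \<open>g ** matrix_inv g\<close>,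
  which is the identity and hence in \<open>GLd \<delta>\<close>.\<close>

lemma matrix_inv_in_GLd:
  assumes "\<And>i. derivation (\<delta> $ i)" "g \<in> GLd \<delta>"
  shows "matrix_inv g \<in> GLd (matrix_inv g \<cdot> \<delta>)"
proof -
  have "invertible g"
    using assms(2) by (simp add: GLd_def GL_def)
  then show ?thesis
    using mult_in_GLd_iff[OF assms, of "matrix_inv g"] mat_one_in_GLd[OF assms(1)]
    by (simp add: invertible_matrix_inv invertible_imp_matrix_inv)
qed

lemma frames_refl:
  assumes "\<And>i. derivation (D $ i)"
  shows "D \<in> frames D"
proof -
  have "matrix_inv (mat 1) \<cdot> D = D"
    by (simp add: matrix_inv_eqI[of "mat 1" "mat 1"])
  then show ?thesis
    unfolding frames_def using mat_one_in_GLd[OF assms] by force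
qed

lemma derivation_frames:
  assumes "\<And>i. derivation (D $ i)" "\<delta> \<in> frames D"
  shows "derivation (\<delta> $ i)"
  using assms derivation_mat_col unfolding frames_def by blast

section \<open>Orbits and their canonical representatives\<close>

theorem theorem2p2:
  fixes D \<delta> :: "('a::field \<Rightarrow> 'a) ^ 'm"
    and W W0 :: "('a \<Rightarrow> 'a) ^ 'm \<Rightarrow> ('a ^ 'l) set"
    and \<tau> :: "('a \<Rightarrow> 'a) ^ 'm \<Rightarrow> 'a ^ 'n ^ 'n \<Rightarrow> 'a ^ 'm ^ 'm \<Rightarrow> 'a ^ 'l \<Rightarrow> 'a ^ 'l"
    and P0 :: "('a \<Rightarrow> 'a) ^ 'm \<Rightarrow> 'a ^ 'l \<Rightarrow> 'a ^ 'n ^ 'n"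
    and P1 :: "('a \<Rightarrow> 'a) ^ 'm \<Rightarrow> 'a ^ 'l \<Rightarrow> 'a ^ 'm ^ 'm"
    and u v :: "'a ^ 'l"
  assumes D_derivations: "commuting_derivations D"
    and D_independent: "lin_independent_over_field D"
    and \<tau>_closed: "\<And>\<epsilon> h g w. \<lbrakk>\<epsilon> \<in> frames D; h \<in> GL; g \<in> GLd \<epsilon>; w \<in> W \<epsilon>\<rbrakk>
          \<Longrightarrow> \<tau> \<epsilon> h g w \<in> W (matrix_inv g \<cdot> \<epsilon>)"
    and \<tau>_unit: "\<And>\<epsilon> w. \<lbrakk>\<epsilon> \<in> frames D; w \<in> W \<epsilon>\<rbrakk> \<Longrightarrow> \<tau> \<epsilon> (mat 1) (mat 1) w = w"
    and \<tau>_comp: "\<And>\<epsilon> h h1 g g1 w.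
          \<lbrakk>\<epsilon> \<in> frames D; h \<in> GL; h1 \<in> GL; g \<in> GLd \<epsilon>; g1 \<in> GLd (matrix_inv g \<cdot> \<epsilon>); w \<in> W \<epsilon>\<rbrakk>
          \<Longrightarrow> \<tau> (matrix_inv g \<cdot> \<epsilon>) h1 g1 (\<tau> \<epsilon> h g w) = \<tau> \<epsilon> (h ** h1) (g ** g1) w"
    and \<tau>_rational: "\<And>k. diff_rational (const_field D)
          {(\<epsilon>, h, g, w). \<epsilon> \<in> frames D \<and> h \<in> GL \<and> g \<in> GLd \<epsilon> \<and> w \<in> W \<epsilon>}
          hgv_coords (\<lambda>\<epsilon> (h, g, w). \<tau> \<epsilon> h g w $ k)"
    and W0_subset: "\<And>\<epsilon>. \<epsilon> \<in> frames D \<Longrightarrow> W0 \<epsilon> \<subseteq> W \<epsilon>"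
    and W0_nonempty: "\<exists>\<epsilon> \<in> frames D. W0 \<epsilon> \<noteq> {}"
    and W0_invariant: "\<And>\<epsilon> h g w. \<lbrakk>\<epsilon> \<in> frames D; h \<in> GL; g \<in> GLd \<epsilon>; w \<in> W0 \<epsilon>\<rbrakk>
          \<Longrightarrow> \<tau> \<epsilon> h g w \<in> W0 (matrix_inv g \<cdot> \<epsilon>)"
    and P0_GL: "\<And>\<epsilon> w. \<lbrakk>\<epsilon> \<in> frames D; w \<in> W0 \<epsilon>\<rbrakk> \<Longrightarrow> P0 \<epsilon> w \<in> GL"
    and P1_GLd: "\<And>\<epsilon> w. \<lbrakk>\<epsilon> \<in> frames D; w \<in> W0 \<epsilon>\<rbrakk> \<Longrightarrow> P1 \<epsilon> w \<in> GLd \<epsilon>"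
    and P0_equivariant: "\<And>\<epsilon> h g w. \<lbrakk>\<epsilon> \<in> frames D; h \<in> GL; g \<in> GLd \<epsilon>; w \<in> W0 \<epsilon>\<rbrakk>
          \<Longrightarrow> P0 (matrix_inv g \<cdot> \<epsilon>) (\<tau> \<epsilon> h g w) = matrix_inv h ** P0 \<epsilon> w"
    and P1_equivariant: "\<And>\<epsilon> h g w. \<lbrakk>\<epsilon> \<in> frames D; h \<in> GL; g \<in> GLd \<epsilon>; w \<in> W0 \<epsilon>\<rbrakk>
          \<Longrightarrow> P1 (matrix_inv g \<cdot> \<epsilon>) (\<tau> \<epsilon> h g w) = matrix_inv g ** P1 \<epsilon> w"
    and P0_rational: "\<And>i j. diff_rational (const_field D)
          {(\<epsilon>, w). \<epsilon> \<in> frames D \<and> w \<in> W0 \<epsilon>} ($) (\<lambda>\<epsilon> w. P0 \<epsilon> w $ i $ j)"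
    and P1_rational: "\<And>i j. diff_rational (const_field D)
          {(\<epsilon>, w). \<epsilon> \<in> frames D \<and> w \<in> W0 \<epsilon>} ($) (\<lambda>\<epsilon> w. P1 \<epsilon> w $ i $ j)"
    and u_in: "u \<in> W0 D"
    and \<delta>_in: "\<delta> \<in> frames D"
    and v_in: "v \<in> W0 \<delta>"
  shows "(\<exists>h \<in> GL. \<exists>g \<in> GLd D. \<delta> = matrix_inv g \<cdot> D \<and> v = \<tau> D h g u)
    \<longleftrightarrow> (matrix_inv (P1 D u) \<cdot> D = matrix_inv (P1 \<delta> v) \<cdot> \<delta> \<and>
         \<tau> D (P0 D u) (P1 D u) u = \<tau> \<delta> (P0 \<delta> v) (P1 \<delta> v) v)"
proof -
  define a b where "a = P1 D u" and "b = P1 \<delta> v"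
  define p q where "p = P0 D u" and "q = P0 \<delta> v"
  have der_D: "derivation (D $ i)" for i
    using D_derivations by (simp add: commuting_derivations_def)
  have der_\<delta>: "derivation (\<delta> $ i)" for i
    by (rule derivation_frames[OF der_D \<delta>_in])
  have D_in: "D \<in> frames D"
    by (rule frames_refl[OF der_D])
  have u_W: "u \<in> W D" and v_W: "v \<in> W \<delta>"
    using W0_subset D_in \<delta>_in u_in v_in by blast+
  have a: "a \<in> GLd D" and b: "b \<in> GLd \<delta>" and p: "p \<in> GL" and q: "q \<in> GL"
    unfolding a_def b_def p_def q_def using P0_GL P1_GLd D_in \<delta>_in u_in v_in by blast+
  have inv: "invertible a" "invertible b" "invertible p" "invertible q"
    using a b p q by (auto simp: GLd_def GL_def)
  have "(\<exists>h \<in> GL. \<exists>g \<in> GLd D. \<delta> = matrix_inv g \<cdot> D \<and> v = \<tau> D h g u)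
    \<longleftrightarrow> (matrix_inv a \<cdot> D = matrix_inv b \<cdot> \<delta> \<and> \<tau> D p a u = \<tau> \<delta> q b v)"
    (is "?equiv \<longleftrightarrow> ?same")
  proof
    assume ?equiv
    then obtain h g where h: "h \<in> GL" and g: "g \<in> GLd D"
      and \<delta>_eq: "\<delta> = matrix_inv g \<cdot> D" and v_eq: "v = \<tau> D h g u"
      by blast
    have inv_hg: "invertible h" "invertible g"
      using h g by (auto simp: GLd_def GL_def)
    have q_eq: "q = matrix_inv h ** p" and b_eq: "b = matrix_inv g ** a"
      unfolding a_def b_def p_def q_def \<delta>_eq v_eq
      using P0_equivariant P1_equivariant D_in h g u_in by blast+
    \<comment> \<open>Solved for \<open>p\<close> and \<open>a\<close>, equivariance says that
      passing from \<open>u\<close> to \<open>v\<close> and then to the representative of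
      \<open>v\<close> uses the same pair as passing directly from \<open>u\<close> to its
      own.\<close>
    have hq: "h ** q = p" and gb: "g ** b = a"
      using inv_hg by (simp_all add: q_eq b_eq matrix_mul_assoc invertible_imp_matrix_inv)
    \<comment> \<open>Since \<open>b = matrix_inv g ** a\<close>, applying \<open>b\<close> to
      \<open>matrix_inv a \<cdot> D\<close> yields \<open>matrix_inv g \<cdot> D\<close>, which is
      \<delta>.\<close>
    have "matrix_inv b \<cdot> \<delta> = matrix_inv b \<cdot> (b \<cdot> (matrix_inv a \<cdot> D))"
      using inv by (simp add: \<delta>_eq b_eq mat_col_mult mat_col_matrix_inv_cancel)
    then have "matrix_inv a \<cdot> D = matrix_inv b \<cdot> \<delta>"
      using inv
      by (simp add: invertible_imp_matrix_inv matrix_mul_assoc flip: mat_col_mult)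
    moreover have "\<tau> \<delta> q b v = \<tau> D p a u"
      using \<tau>_comp[OF D_in h q g _ u_W] b by (simp add: \<delta>_eq v_eq hq gb)
    ultimately show ?same
      by simp
  next
    assume same: ?same
    \<comment> \<open>The forward direction forces \<open>g ** b = a\<close> and
      \<open>h ** q = p\<close>, so these are the only possible witnesses.\<close>
    define g h where "g = a ** matrix_inv b" and "h = p ** matrix_inv q"
    have inv_b: "matrix_inv b \<in> GLd (matrix_inv b \<cdot> \<delta>)"
      by (rule matrix_inv_in_GLd[OF der_\<delta> b])
    \<comment> \<open>Equality of the representatives' columns makes \<open>matrix_inv b\<close>
      composable after \<open>a\<close>.\<close>
    then have inv_b': "matrix_inv b \<in> GLd (matrix_inv a \<cdot> D)"
      using same by simp
    have g: "g \<in> GLd D"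
      unfolding g_def mult_in_GLd_iff[OF der_D a invertible_matrix_inv[OF inv(2)]]
      by (rule inv_b')
    have inv_q: "matrix_inv q \<in> GL"
      using inv by (simp add: GL_def invertible_matrix_inv)
    then have h: "h \<in> GL"
      using inv by (simp add: h_def GL_def invertible_mult)
    have "\<delta> = b \<cdot> (matrix_inv a \<cdot> D)"
      using same inv by (simp add: mat_col_matrix_inv_cancel)
    then have "\<delta> = matrix_inv g \<cdot> D"
      using inv by (simp add: g_def matrix_inv_quotient mat_col_mult)
    moreover have "v = \<tau> D h g u"
    proof -
      \<comment> \<open>The transport is split at the representative of \<open>u\<close>, which is
        replaced, column and point together, by that of \<open>v\<close>; there the inverse of
        \<open>(q, b)\<close> leads back to \<open>v\<close>.\<close>
      have "\<tau> D h g u = \<tau> (matrix_inv a \<cdot> D) (matrix_inv q) (matrix_inv b) (\<tau> D p a u)"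
        using \<tau>_comp[OF D_in p inv_q a inv_b' u_W] by (simp add: g_def h_def)
      also have "\<dots> = \<tau> (matrix_inv b \<cdot> \<delta>) (matrix_inv q) (matrix_inv b) (\<tau> \<delta> q b v)"
        using same by simp
      also have "\<dots> = \<tau> \<delta> (mat 1) (mat 1) v"
        using \<tau>_comp[OF \<delta>_in q inv_q b inv_b v_W] inv by (simp add: invertible_imp_matrix_inv)
      also have "\<dots> = v"
        by (rule \<tau>_unit[OF \<delta>_in v_W])
      finally show ?thesis ..
    qed
    ultimately show ?equiv
      using g h by blast
  qed
  then show ?thesis
    by (simp only: a_def b_def p_def q_def)
qed

end
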